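(* Let $k\ge2$, $n\ge1$, let $\tilde\gamma_1,\dots,\tilde\gamma_k\in\mathbb R^m$ be distinct, put $\Delta_{\min}=\min_{a\ne b}\|\tilde\gamma_a-\tilde\gamma_b\|_2$, and let $c_{a,i}\in\mathbb R^m$ for $a\in\{1,\dots,k\}$, $i\in\{1,\dots,n\}$. Take $\epsilon<\Delta_{\min}/8$, suppose $$\#\big\{(a,i):\|c_{a,i}-\tilde\gamma_a\|_2>\epsilon\big\}<\frac n2,$$ and consider the graph $G$ with vertices $\{c_{a,i}\}$ (indexed by the pairs $(a,i)$, so counted with multiplicity) in which distinct vertices $c_{a,i}$ and $c_{b,j}$ are adjacent if $\|c_{a,i}-c_{b,j}\|_2\le2\epsilon$. For each $i=1,\dots,k$ in turn, select the vertex $v_i$ of maximum degree in the current graph $G$ (breaking ties arbitrarily) and update $G$ by removing every vertex $w$ such that $\|w-v_i\|_2\le4\epsilon$. Then there exists a permutation $\pi$ of $\{1,\dots,k\}$ such that $$\|v_i-\tilde\gamma_{\pi(i)}\|_2\le3\epsilon$$ for every $i\in\{1,\dots,k\}$.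
   Context: When vertices are removed, the edges incident to them are removed as well, and degrees at each step are computed in the current graph. Part of the assertion is that the procedure can be carried out for all $k$ steps. *)

theory Defs
  imports "HOL-Analysis.Analysis"
begin

record 'v graph =
  verts :: "'v set"
  edges :: "'v set set"

definition vertex_degree :: "'v graph \<Rightarrow> 'v \<Rightarrow> nat" where
  "vertex_degree G v = card {e \<in> edges G. v \<in> e}"

definition remove_verts :: "'v graph \<Rightarrow> 'v set \<Rightarrow> 'v graph" where
  "remove_verts G W = \<lparr>verts = verts G - W, edges = {e \<in> edges G. e \<inter> W = {}}\<rparr>"

text \<open>
  Vertices are indices; \<open>p\<close> assigns to each index its point. Indices with equal points remain
  different vertices, so points are counted with multiplicity.
\<close>

definition proximity_graph ::
    "'v set \<Rightarrow> ('v \<Rightarrow> 'a::real_normed_vector) \<Rightarrow> real \<Rightarrow> 'v graph" where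
  "proximity_graph V p r =
     \<lparr>verts = V, edges = {{u, w} | u w. u \<in> V \<and> w \<in> V \<and> u \<noteq> w \<and> norm (p u - p w) \<le> r}\<rparr>"

text \<open>
  The vertices selected in steps 1, 2, ... are \<open>v 1\<close>, \<open>v 2\<close>, ...; the value \<open>v 0\<close> is never used.
  \<open>current_graph p r G v i\<close> is the graph left after the first \<open>i\<close> steps.
\<close>

primrec current_graph ::
    "('v \<Rightarrow> 'a::real_normed_vector) \<Rightarrow> real \<Rightarrow> 'v graph \<Rightarrow> (nat \<Rightarrow> 'v) \<Rightarrow> nat \<Rightarrow> 'v graph" where
  "current_graph p r G v 0 = G"
| "current_graph p r G v (Suc i) =
     remove_verts (current_graph p r G v i) {w. norm (p w - p (v (Suc i))) \<le> r}"

text \<open>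
  \<open>greedy_run p r G l v\<close>: the values \<open>v 1\<close>, ..., \<open>v l\<close> are the selections of a possible execution
  of the first \<open>l\<close> steps. Ties are resolved in an arbitrary way, so this is a relation.
\<close>

definition greedy_run ::
    "('v \<Rightarrow> 'a::real_normed_vector) \<Rightarrow> real \<Rightarrow> 'v graph \<Rightarrow> nat \<Rightarrow> (nat \<Rightarrow> 'v) \<Rightarrow> bool" where
  "greedy_run p r G l v \<longleftrightarrow>
     (\<forall>i\<in>{1..l}. let H = current_graph p r G v (i - 1)
                 in is_arg_max (vertex_degree H) (\<lambda>u. u \<in> verts H) (v i))"

end

theory Submission
  imports Defs
begin

text \<open>
  Call \<open>(a, i)\<close> good if \<open>c a i\<close> is within \<open>\<epsilon>\<close> of \<open>\<gamma> a\<close>, and bad otherwise. The good vertices of one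
  cluster form a clique with more than \<open>n / 2\<close> vertices, while there are fewer than \<open>n / 2\<close> bad
  vertices. Hence, as long as some cluster has all its good vertices, a vertex of maximum degree
  cannot have only bad vertices in its closed neighbourhood, so it is within \<open>2\<epsilon> + \<epsilon>\<close> of some
  \<open>\<gamma> a\<close> whose cluster still has a good vertex. Since centres are more than \<open>8\<epsilon>\<close> apart, removing
  the \<open>4\<epsilon>\<close>-ball deletes all good vertices of this cluster and none of any other, so each
  step uses up exactly one cluster.
\<close>

lemma remove_verts_proximity_graph:
  "remove_verts (proximity_graph V p r) W = proximity_graph (V - W) p r"
  unfolding remove_verts_def proximity_graph_def by auto

text \<open>Deleting vertices from a proximity graph leaves the proximity graph of the survivors.
  The state of a run is therefore just its surviving vertex set, and the rest of the proof works
  with that set.\<close>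

lemma current_graph_proximity_graph:
  "current_graph p R (proximity_graph V p r) v l =
     proximity_graph {u \<in> V. \<forall>i\<in>{1..l}. norm (p u - p (v i)) > R} p r"
proof (induction l)
  case (Suc l)
  have "{u \<in> V. \<forall>i\<in>{1..l}. norm (p u - p (v i)) > R} - {w. norm (p w - p (v (Suc l))) \<le> R} =
        {u \<in> V. \<forall>i\<in>{1..Suc l}. norm (p u - p (v i)) > R}"
    by (auto simp: atLeastAtMostSuc_conv)
  then show ?case
    using Suc by (simp add: remove_verts_proximity_graph)
qed simp

lemma verts_proximity_graph [simp]: "verts (proximity_graph V p r) = V"
  by (simp add: proximity_graph_def)

text \<open>Edges are two-element sets, so \<open>w\<close> mapped to \<open>{v, w}\<close> is a
  bijection from the neighbours of \<open>v\<close> onto its incident edges.\<close>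

lemma vertex_degree_proximity_graph:
  assumes "v \<in> V"
  shows "vertex_degree (proximity_graph V p r) v = card {w \<in> V. w \<noteq> v \<and> norm (p v - p w) \<le> r}"
proof -
  have "{e \<in> edges (proximity_graph V p r). v \<in> e} =
        (\<lambda>w. {v, w}) ` {w \<in> V. w \<noteq> v \<and> norm (p v - p w) \<le> r}"
    using assms unfolding proximity_graph_def
    by (auto simp: image_iff norm_minus_commute doubleton_eq_iff)
  moreover have "inj_on (\<lambda>w. {v, w}) {w \<in> V. w \<noteq> v \<and> norm (p v - p w) \<le> r}"
    by (auto simp: inj_on_def doubleton_eq_iff)
  ultimately show ?thesis
    unfolding vertex_degree_def by (simp add: card_image)
qed

text \<open>This allows the total function \<open>v\<close> to be overridden at \<open>Suc l\<close>
  without disturbing the first \<open>l\<close> steps, as is done when a run is extended.\<close>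

lemma current_graph_cong:
  assumes "\<And>i. i \<in> {1..l} \<Longrightarrow> v i = w i"
  shows "current_graph p r G v l = current_graph p r G w l"
  using assms by (induction l) auto

lemma greedy_run_cong:
  assumes "\<And>i. i \<in> {1..l} \<Longrightarrow> v i = w i"
  shows "greedy_run p r G l v \<longleftrightarrow> greedy_run p r G l w"
proof -
  have "current_graph p r G v (i - 1) = current_graph p r G w (i - 1)" if "i \<in> {1..l}" for i
    using that assms by (intro current_graph_cong) auto
  then show ?thesis
    unfolding greedy_run_def Let_def using assms by auto
qed

lemma greedy_run_Suc:
  "greedy_run p r G (Suc l) v \<longleftrightarrow> greedy_run p r G l v \<and>
     is_arg_max (vertex_degree (current_graph p r G v l))
       (\<lambda>u. u \<in> verts (current_graph p r G v l)) (v (Suc l))"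
  unfolding greedy_run_def by (auto simp: atLeastAtMostSuc_conv Let_def)

text \<open>Here \<open>S a\<close> stands for the good vertices of cluster \<open>a\<close>. The
  bound n/2 enters only through its consequence \<open>few_bad\<close>: each cluster has more good
  vertices than there are bad vertices altogether.\<close>

locale separated_clusters =
  fixes V :: "'v set" and p :: "'v \<Rightarrow> 'a::real_normed_vector"
    and A :: "'i set" and \<gamma> :: "'i \<Rightarrow> 'a" and S :: "'i \<Rightarrow> 'v set" and \<epsilon> :: real
  assumes finite_V: "finite V"
    and S_subset: "a \<in> A \<Longrightarrow> S a \<subseteq> V"
    and S_close: "a \<in> A \<Longrightarrow> u \<in> S a \<Longrightarrow> norm (p u - \<gamma> a) \<le> \<epsilon>"
    and few_bad: "a \<in> A \<Longrightarrow> card (V - (\<Union>b\<in>A. S b)) < card (S a)"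
    and separated: "a \<in> A \<Longrightarrow> b \<in> A \<Longrightarrow> a \<noteq> b \<Longrightarrow> norm (\<gamma> a - \<gamma> b) > 8 * \<epsilon>"
begin

lemma S_nonempty: "a \<in> A \<Longrightarrow> S a \<noteq> {}"
  using few_bad by fastforce

text \<open>The distances \<epsilon> and 3\<epsilon> to the common centre add up to exactly the
  removal radius.\<close>

lemma S_removed:
  assumes "a \<in> A" "u \<in> S a" "norm (x - \<gamma> a) \<le> 3 * \<epsilon>"
  shows "norm (p u - x) \<le> 4 * \<epsilon>"
  using norm_triangle_ineq4[of "p u - \<gamma> a" "x - \<gamma> a"] S_close[OF assms(1,2)] assms(3) by simp

text \<open>Of the more than 8\<epsilon> between the two centres, at most \<epsilon> + 3\<epsilon>
  is lost, so more than 4\<epsilon> remains.\<close>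

lemma S_retained:
  assumes "a \<in> A" "b \<in> A" "a \<noteq> b" "u \<in> S b" "norm (x - \<gamma> a) \<le> 3 * \<epsilon>"
  shows "norm (p u - x) > 4 * \<epsilon>"
proof -
  have "norm (\<gamma> a - \<gamma> b) \<le> norm (p u - \<gamma> b) + norm (p u - x) + norm (x - \<gamma> a)"
    using norm_triangle_ineq4[of "p u - \<gamma> b" "p u - x"]
      norm_triangle_ineq4[of "x - \<gamma> b" "x - \<gamma> a"] by simp
  then show ?thesis
    using separated[OF assms(1-3)] S_close[OF assms(2,4)] assms(5) by linarith
qed

lemma max_degree_near_centre:
  assumes U: "U \<subseteq> V" and a: "a \<in> A" "S a \<subseteq> U"
    and v: "is_arg_max (vertex_degree (proximity_graph U p (2 * \<epsilon>))) (\<lambda>u. u \<in> U) v"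
  obtains b where "b \<in> A" "S b \<inter> U \<noteq> {}" "norm (p v - \<gamma> b) \<le> 3 * \<epsilon>"
proof -
  define N where "N = (\<lambda>v. {w \<in> U. w \<noteq> v \<and> norm (p v - p w) \<le> 2 * \<epsilon>})"
  have finU: "finite U"
    using U finite_V finite_subset by blast
  have vU: "v \<in> U"
    using v by (simp add: is_arg_max_def)
  obtain s where s: "s \<in> S a"
    using S_nonempty a(1) by blast
  \<comment> \<open>Nonnegativity follows from the existence of a good vertex. It is needed below
    when the good vertex found is \<open>v\<close> itself.\<close>
  have eps: "0 \<le> \<epsilon>"
    using S_close[OF a(1) s] norm_ge_zero order_trans by blast
  have "insert s (N s) \<supseteq> S a"
  proof
    fix w assume w: "w \<in> S a"
    have "norm (p s - p w) \<le> 2 * \<epsilon>"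
      using norm_triangle_ineq4[of "p s - \<gamma> a" "p w - \<gamma> a"] S_close[OF a(1) s] S_close[OF a(1) w]
      by simp
    then show "w \<in> insert s (N s)"
      using w a(2) by (auto simp: N_def)
  qed
  then have "card (S a) \<le> card (insert s (N s))"
    using finU by (intro card_mono) (auto simp: N_def)
  also have "\<dots> \<le> Suc (card (N s))"
    by (rule card_insert_le_m1) auto
  also have "card (N s) \<le> card (N v)"
  proof -
    have deg: "vertex_degree (proximity_graph U p (2 * \<epsilon>)) x = card (N x)" if "x \<in> U" for x
      using vertex_degree_proximity_graph[OF that] by (simp add: N_def)
    have sU: "s \<in> U"
      using s a(2) by blast
    show ?thesis
      using v sU deg[OF sU] deg[OF vU] by (auto simp: is_arg_max_linorder)
  qed
  also have "Suc (card (N v)) = card (insert v (N v))"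
    using finU by (subst card_insert_disjoint) (auto simp: N_def)
  finally have "card (V - (\<Union>b\<in>A. S b)) < card (insert v (N v))"
    using few_bad[OF a(1)] by linarith
  then have "\<not> insert v (N v) \<subseteq> V - (\<Union>b\<in>A. S b)"
    using finite_V card_mono[of "V - (\<Union>b\<in>A. S b)" "insert v (N v)"] by auto
  then obtain w where w: "w \<in> insert v (N v)" "w \<notin> V - (\<Union>b\<in>A. S b)"
    by blast
  have wU: "w \<in> U" and close: "norm (p v - p w) \<le> 2 * \<epsilon>"
    using w(1) vU eps by (auto simp: N_def)
  obtain b where b: "b \<in> A" "w \<in> S b"
    using w(2) wU U by blast
  have "norm (p v - \<gamma> b) \<le> 3 * \<epsilon>"
    using norm_triangle_ineq[of "p v - p w" "p w - \<gamma> b"] close S_close[OF b] by simp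
  with b wU show thesis
    by (intro that) auto
qed

text \<open>Pigeonhole: fewer than \<open>card A\<close> selections leave some centre unmatched, and
  by \<open>S_retained\<close> none of the removals touches its good vertices.\<close>

lemma intact_cluster:
  assumes f: "inj_on f {1..l}" "f ` {1..l} \<subseteq> A"
      "\<And>i. i \<in> {1..l} \<Longrightarrow> norm (p (v i) - \<gamma> (f i)) \<le> 3 * \<epsilon>"
    and "l < card A"
  obtains a where "a \<in> A" "S a \<subseteq> {u \<in> V. \<forall>i\<in>{1..l}. norm (p u - p (v i)) > 4 * \<epsilon>}"
proof -
  have "card (f ` {1..l}) < card A"
    using f(1) assms(4) by (simp add: card_image)
  then obtain a where a: "a \<in> A" "a \<notin> f ` {1..l}"
    using f(2) by (metis card_mono finite_atLeastAtMost finite_imageI not_less subsetI)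
  have "S a \<subseteq> {u \<in> V. \<forall>i\<in>{1..l}. norm (p u - p (v i)) > 4 * \<epsilon>}"
    using a f S_subset S_retained[of "f _" a] by blast
  with a(1) show thesis
    by (rule that)
qed

text \<open>Induction on the number of steps: an intact cluster makes
  \<open>max_degree_near_centre\<close> applicable to the next selection, and the centre it yields
  extends the matching \<open>f\<close>.\<close>

lemma greedy_run_selects_centres:
  assumes "greedy_run p (4 * \<epsilon>) (proximity_graph V p (2 * \<epsilon>)) l v" "finite A" "l \<le> card A"
  shows "\<exists>f. inj_on f {1..l} \<and> f ` {1..l} \<subseteq> A \<and> (\<forall>i\<in>{1..l}. norm (p (v i) - \<gamma> (f i)) \<le> 3 * \<epsilon>)"
  using assms
proof (induction l)
  case (Suc l)
  define U where "U = {u \<in> V. \<forall>i\<in>{1..l}. norm (p u - p (v i)) > 4 * \<epsilon>}"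
  obtain f where f: "inj_on f {1..l}" "f ` {1..l} \<subseteq> A"
      "\<And>i. i \<in> {1..l} \<Longrightarrow> norm (p (v i) - \<gamma> (f i)) \<le> 3 * \<epsilon>"
    using Suc by (auto simp: greedy_run_Suc)
  obtain a where a: "a \<in> A" "S a \<subseteq> U"
    using intact_cluster[OF f] Suc.prems(3) unfolding U_def by auto
  have "is_arg_max (vertex_degree (proximity_graph U p (2 * \<epsilon>))) (\<lambda>u. u \<in> U) (v (Suc l))"
    using Suc.prems(1) unfolding greedy_run_Suc current_graph_proximity_graph U_def by simp
  then obtain b where b: "b \<in> A" "S b \<inter> U \<noteq> {}" "norm (p (v (Suc l)) - \<gamma> b) \<le> 3 * \<epsilon>"
    using max_degree_near_centre[of U a] a U_def by blast
  \<comment> \<open>Had \<open>b\<close> been matched at step \<open>i\<close>, that step would have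
    deleted all of \<open>S b\<close>, yet \<open>S b\<close> still meets \<open>U\<close>.\<close>
  have "b \<notin> f ` {1..l}"
  proof
    assume "b \<in> f ` {1..l}"
    then obtain i where i: "i \<in> {1..l}" "b = f i"
      by blast
    obtain u where u: "u \<in> S b" "u \<in> U"
      using b(2) by blast
    show False
      using S_removed[OF b(1) u(1), of "p (v i)"] f(3)[OF i(1)] i u(2)
      by (auto simp: U_def not_less[symmetric])
  qed
  show ?case
  proof (intro exI[of _ "f(Suc l := b)"] conjI ballI)
    have Suc_l: "{1..Suc l} = insert (Suc l) {1..l}"
      by auto
    have upd: "(f(Suc l := b)) ` {1..l} = f ` {1..l}"
      by (rule image_cong) auto
    have "inj_on (f(Suc l := b)) {1..l}"
      using f(1) by (rule inj_on_cong[THEN iffD1, rotated]) auto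
    then show "inj_on (f(Suc l := b)) {1..Suc l}"
      using \<open>b \<notin> f ` {1..l}\<close> upd unfolding Suc_l by simp
    show "(f(Suc l := b)) ` {1..Suc l} \<subseteq> A"
      using f(2) b(1) unfolding Suc_l image_insert upd by simp
    show "norm (p (v i) - \<gamma> ((f(Suc l := b)) i)) \<le> 3 * \<epsilon>" if "i \<in> {1..Suc l}" for i
      using f(3)[of i] b(3) that by (cases "i = Suc l") auto
  qed
qed simp

text \<open>After any run of \<open>l\<close> steps, however ties were broken, an intact cluster
  makes the current graph nonempty; being finite, it has a vertex of maximum degree.\<close>

lemma greedy_run_continues:
  assumes run: "greedy_run p (4 * \<epsilon>) (proximity_graph V p (2 * \<epsilon>)) l v" and "finite A" "l < card A"
  shows "\<exists>u. greedy_run p (4 * \<epsilon>) (proximity_graph V p (2 * \<epsilon>)) (Suc l) (v(Suc l := u))"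
proof -
  define U where "U = {u \<in> V. \<forall>i\<in>{1..l}. norm (p u - p (v i)) > 4 * \<epsilon>}"
  obtain f where f: "inj_on f {1..l}" "f ` {1..l} \<subseteq> A"
      "\<And>i. i \<in> {1..l} \<Longrightarrow> norm (p (v i) - \<gamma> (f i)) \<le> 3 * \<epsilon>"
    using greedy_run_selects_centres[OF run] assms by (meson less_imp_le)
  obtain a where a: "a \<in> A" "S a \<subseteq> U"
    using intact_cluster[OF f] assms(3) unfolding U_def by auto
  then have "U \<noteq> {}" "finite U"
    using S_nonempty[OF a(1)] finite_V unfolding U_def by auto
  then obtain u where u: "is_arg_max (vertex_degree (proximity_graph U p (2 * \<epsilon>))) (\<lambda>u. u \<in> U) u"
    using Max_in[of "vertex_degree (proximity_graph U p (2 * \<epsilon>)) ` U"]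
      Max_ge[of "vertex_degree (proximity_graph U p (2 * \<epsilon>)) ` U"]
    by (fastforce simp: is_arg_max_linorder)
  have "greedy_run p (4 * \<epsilon>) (proximity_graph V p (2 * \<epsilon>)) l (v(Suc l := u))"
    using run by (subst greedy_run_cong[of _ _ v]) auto
  moreover have "current_graph p (4 * \<epsilon>) (proximity_graph V p (2 * \<epsilon>)) (v(Suc l := u)) l =
      proximity_graph U p (2 * \<epsilon>)"
    unfolding U_def current_graph_proximity_graph[symmetric]
    by (rule current_graph_cong) auto
  ultimately show ?thesis
    using u by (auto simp: greedy_run_Suc)
qed

end

text \<open>The first conjunct says that no execution gets stuck before step \<open>k\<close>;
  without it the claim about complete runs could hold vacuously.\<close>

theorem theorem15:
  fixes k n :: nat
    and \<gamma> :: "nat \<Rightarrow> real ^ 'm"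
    and c :: "nat \<Rightarrow> nat \<Rightarrow> real ^ 'm"
    and \<Delta>min \<epsilon> :: real
    and p :: "nat \<times> nat \<Rightarrow> real ^ 'm"
    and G :: "(nat \<times> nat) graph"
  assumes "k \<ge> 2" and "n \<ge> 1"
    and "inj_on \<gamma> {1..k}"
    and "\<Delta>min = Min {norm (\<gamma> a - \<gamma> b) | a b. a \<in> {1..k} \<and> b \<in> {1..k} \<and> a \<noteq> b}"
    and "\<epsilon> < \<Delta>min / 8"
    and "real (card {(a, i). a \<in> {1..k} \<and> i \<in> {1..n} \<and> norm (c a i - \<gamma> a) > \<epsilon>}) < real n / 2"
    and "p = (\<lambda>(a, i). c a i)"
    and "G = proximity_graph ({1..k} \<times> {1..n}) p (2 * \<epsilon>)"
  shows "(\<forall>l<k. \<forall>v. greedy_run p (4 * \<epsilon>) G l v \<longrightarrow>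
            (\<exists>u. greedy_run p (4 * \<epsilon>) G (Suc l) (v(Suc l := u)))) \<and>
         (\<forall>v. greedy_run p (4 * \<epsilon>) G k v \<longrightarrow>
            (\<exists>\<pi>. \<pi> permutes {1..k} \<and>
                 (\<forall>i\<in>{1..k}. norm (p (v i) - \<gamma> (\<pi> i)) \<le> 3 * \<epsilon>)))"
proof -
  define V where "V = {1..k} \<times> {1..n}"
  \<comment> \<open>Membership depends on the index: a vertex of another cluster that happens to lie
    near \<open>\<gamma> a\<close> is not counted in \<open>S a\<close>.\<close>
  define S where "S = (\<lambda>a. {u \<in> {a} \<times> {1..n}. norm (p u - \<gamma> a) \<le> \<epsilon>})"
  define B where "B = {(a, i). a \<in> {1..k} \<and> i \<in> {1..n} \<and> norm (c a i - \<gamma> a) > \<epsilon>}"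
  have B: "V - (\<Union>b\<in>{1..k}. S b) = B"
    unfolding V_def S_def B_def assms(7) by auto
  have finB: "finite B"
    by (rule finite_subset[of _ V]) (auto simp: B_def V_def)
  have "separated_clusters V p {1..k} \<gamma> S \<epsilon>"
  proof
    show "finite V"
      by (simp add: V_def)
    show "S a \<subseteq> V" if "a \<in> {1..k}" for a
      using that by (auto simp: S_def V_def)
    show "norm (p u - \<gamma> a) \<le> \<epsilon>" if "u \<in> S a" for a u
      using that by (simp add: S_def)
    show "card (V - (\<Union>b\<in>{1..k}. S b)) < card (S a)" if a: "a \<in> {1..k}" for a
    proof -
      \<comment> \<open>The \<open>n\<close> vertices of cluster \<open>a\<close> are good or bad,
        so fewer than n/2 bad ones force more than n/2 good ones.\<close>
      have "{a} \<times> {1..n} \<subseteq> S a \<union> B"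
        using a by (auto simp: S_def B_def assms(7))
      moreover have "finite (S a)"
        by (simp add: S_def)
      ultimately have "card ({a} \<times> {1..n}) \<le> card (S a) + card B"
        using finB by (meson card_Un_le card_mono finite_UnI order_trans)
      then show ?thesis
        using assms(6) unfolding B B_def[symmetric] by simp
    qed
    show "norm (\<gamma> a - \<gamma> b) > 8 * \<epsilon>" if "a \<in> {1..k}" "b \<in> {1..k}" "a \<noteq> b" for a b
    proof -
      let ?D = "{norm (\<gamma> a - \<gamma> b) | a b. a \<in> {1..k} \<and> b \<in> {1..k} \<and> a \<noteq> b}"
      have "finite ?D"
        by (rule finite_subset[of _ "(\<lambda>(a, b). norm (\<gamma> a - \<gamma> b)) ` ({1..k} \<times> {1..k})"]) auto
      then have "Min ?D \<le> norm (\<gamma> a - \<gamma> b)"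
        using that by (intro Min_le) auto
      then show ?thesis
        using assms(4,5) by simp
    qed
  qed
  then interpret separated_clusters V p "{1..k}" \<gamma> S \<epsilon> .
  have G: "G = proximity_graph V p (2 * \<epsilon>)"
    using assms(8) by (simp add: V_def)
  have "\<exists>\<pi>. \<pi> permutes {1..k} \<and> (\<forall>i\<in>{1..k}. norm (p (v i) - \<gamma> (\<pi> i)) \<le> 3 * \<epsilon>)"
    if "greedy_run p (4 * \<epsilon>) G k v" for v
  proof -
    have "k \<le> card {1..k}"
      by simp
    from greedy_run_selects_centres[OF that[unfolded G] finite_atLeastAtMost this]
    obtain f where f: "inj_on f {1..k}" "f ` {1..k} \<subseteq> {1..k}"
        "\<forall>i\<in>{1..k}. norm (p (v i) - \<gamma> (f i)) \<le> 3 * \<epsilon>"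
      by (elim exE conjE)
    \<comment> \<open>A permutation of \<open>{1..k}\<close> must fix everything outside, where
      \<open>f\<close> is arbitrary. Inside, \<open>f\<close> is onto because it is an injective
      self-map of a finite set.\<close>
    define \<pi> where "\<pi> = (\<lambda>i. if i \<in> {1..k} then f i else i)"
    have "bij_betw f {1..k} {1..k}"
      using f(1,2) unfolding bij_betw_def by (simp only: endo_inj_surj finite_atLeastAtMost simp_thms)
    then have "bij_betw \<pi> {1..k} {1..k}"
      by (rule bij_betw_cong[THEN iffD1, rotated]) (simp add: \<pi>_def)
    then have "\<pi> permutes {1..k}"
      by (rule bij_imp_permutes) (simp only: \<pi>_def if_False)
    moreover have "\<forall>i\<in>{1..k}. norm (p (v i) - \<gamma> (\<pi> i)) \<le> 3 * \<epsilon>"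
      using f(3) by (simp add: \<pi>_def)
    ultimately show ?thesis
      by blast
  qed
  then show ?thesis
    using greedy_run_continues[folded G] by simp
qed

end
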